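(* Let $\Delta t>0$ and $N_t\in\mathbb{N}$, $N_t\ge 1$, be arbitrary, let $M>0$ and $0<\varepsilon\le 1$, and let $\phi^0=\phi_0$ be given on $\Omega$, with $R^0=\exp(E(\phi^0))$. Suppose that $(\phi^{n})_{0\le n\le N_t}$, $(\mu^{n})_{1\le n\le N_t}$ (real-valued functions on $\Omega$) and $(R^n)_{0\le n\le N_t}$ (real numbers) satisfy the first-order ESI-SAV scheme for the nonlocal Cahn-Hilliard equation: for all $0\le n\le N_t-1$, $$\frac{\phi^{n+1}-\phi^n}{\Delta t}=-M\mathcal{L}\mu^{n+1},$$ $$\mu^{n+1}=\varepsilon^2\mathcal{L}\phi^{n+1}+\frac{R^{n+1}}{\exp(E(\phi^n))}f(\phi^n),$$ $$\frac{R^{n+1}-R^n}{\Delta t}=R^{n+1}\left(-M\mathcal{L}\bar\mu^n,\bar\mu^n\right),$$ where $\bar\mu^n=\varepsilon^2\mathcal{L}\phi^n+f(\phi^n)$. Then the scheme is unconditionally energy stable, in the sense that, with no restriction on $\Delta t$, for all $0\le n\le N_t-1$, $$R^{n+1}-R^n=-R^{n+1}\Delta t\left(M\mathcal{L}\bar\mu^n,\bar\mu^n\right)\le 0,$$ and moreover $$\ln R^{n+1}-\ln R^n\le 0.$$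
   Context: $\Omega\subset\mathbb{R}^d$ ($d=1,2,3$) is a bounded rectangular cell. $(\phi,\varphi)=\int_\Omega\phi(\mathbf{x})\varphi(\mathbf{x})\,d\mathbf{x}$ is the $L^2(\Omega)$ inner product. All functions are real-valued. The interaction kernel $J$ is integrable on $\Omega$ and satisfies: (a) $J(\mathbf{x})\ge 0$ for all $\mathbf{x}\in\Omega$; (b) $J(\mathbf{x})=J(-\mathbf{x})$; (c) $J$ is $\Omega$-periodic (periodic in each coordinate with period the corresponding side length of $\Omega$); (d) $J$ is radial, meaning that on the period cell centred at the origin $J(\mathbf{x})$ depends only on $|\mathbf{x}|$. The nonlocal diffusion operator is $$\mathcal{L}\phi(\mathbf{x})=\int_\Omega J(\mathbf{x}-\mathbf{y})\left(\phi(\mathbf{x})-\phi(\mathbf{y})\right)d\mathbf{y},\quad \mathbf{x}\in\Omega.$$ $F:\mathbb{R}\to\mathbb{R}$ is a general nonlinear $C^1$ potential (typical example: $F(\phi)=\frac14(\phi^2-1)^2$) and $f=F'$. The free energy is $$E(\phi)=\frac{\varepsilon^2}{2}(\mathcal{L}\phi,\phi)+\int_\Omega F(\phi)\,d\mathbf{x}.$$ The nonlocal Cahn-Hilliard equation is $\partial_t\phi=-M\mathcal{L}\mu$, $\mu=\varepsilon^2\mathcal{L}\phi+f(\phi)$, with mobility constant $M>0$. In the scheme, $R^n$ approximates the exponential scalar auxiliary variable $R(t)=\exp(E(\phi(t)))$. Functions are $\Omega$-periodic and assumed regular enough that all expressions are well defined; in particular $\phi^n$, $f(\phi^n)$, $\mu^n$,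 $\bar\mu^n$ belong to $L^2(\Omega)$ and $E(\phi^n)$ is finite. *)

theory Defs
  imports "HOL-Analysis.Analysis"
begin

text \<open>The cell \<open>\<Omega>\<close> is the open box \<open>box a b\<close> in \<open>\<real>\<^sup>d\<close>; its \<open>i\<close>-th side has length \<open>b $ i - a $ i\<close>.
  Functions on the cell are represented by functions on the whole space, and integrals are
  Lebesgue integrals.\<close>

definition cell_periodic :: "real^'d \<Rightarrow> real^'d \<Rightarrow> (real^'d \<Rightarrow> real) \<Rightarrow> bool" where
  "cell_periodic a b u \<longleftrightarrow> (\<forall>x i. u (x + axis i (b $ i - a $ i)) = u x)"

definition square_integrable :: "(real^'d) set \<Rightarrow> (real^'d \<Rightarrow> real) \<Rightarrow> bool" where
  "square_integrable \<Omega> u \<longleftrightarrow>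
     u \<in> borel_measurable (lebesgue_on \<Omega>) \<and> integrable (lebesgue_on \<Omega>) (\<lambda>x. (u x)\<^sup>2)"

definition L2_inner :: "(real^'d) set \<Rightarrow> (real^'d \<Rightarrow> real) \<Rightarrow> (real^'d \<Rightarrow> real) \<Rightarrow> real" where
  "L2_inner \<Omega> u v = (LINT x|lebesgue_on \<Omega>. u x * v x)"

text \<open>The box in the radiality clause is the period cell centred at the origin, which need not be
  \<open>box a b\<close> itself.\<close>

definition interaction_kernel :: "real^'d \<Rightarrow> real^'d \<Rightarrow> (real^'d \<Rightarrow> real) \<Rightarrow> bool" where
  "interaction_kernel a b J \<longleftrightarrow>
     integrable (lebesgue_on (box a b)) J \<and>
     (\<forall>x \<in> box a b. 0 \<le> J x) \<and>
     (\<forall>x. J x = J (- x)) \<and>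
     cell_periodic a b J \<and>
     (\<exists>\<rho>. \<forall>x \<in> box (- ((b - a) /\<^sub>R 2)) ((b - a) /\<^sub>R 2). J x = \<rho> (norm x))"

definition nonlocal_op ::
    "(real^'d) set \<Rightarrow> (real^'d \<Rightarrow> real) \<Rightarrow> (real^'d \<Rightarrow> real) \<Rightarrow> real^'d \<Rightarrow> real" where
  "nonlocal_op \<Omega> J u x = (LINT y|lebesgue_on \<Omega>. J (x - y) * (u x - u y))"

definition free_energy ::
    "(real^'d) set \<Rightarrow> (real^'d \<Rightarrow> real) \<Rightarrow> real \<Rightarrow> (real \<Rightarrow> real) \<Rightarrow> (real^'d \<Rightarrow> real) \<Rightarrow> real" where
  "free_energy \<Omega> J \<epsilon> F u =
     \<epsilon>\<^sup>2 / 2 * L2_inner \<Omega> (nonlocal_op \<Omega> J u) u + (LINT x|lebesgue_on \<Omega>. F (u x))"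

text \<open>Bochner integrals of non-integrable functions are \<open>0\<close> by convention, so finiteness of the
  energy has to be stated as integrability of both of its densities.\<close>

definition finite_energy ::
    "(real^'d) set \<Rightarrow> (real^'d \<Rightarrow> real) \<Rightarrow> (real \<Rightarrow> real) \<Rightarrow> (real^'d \<Rightarrow> real) \<Rightarrow> bool" where
  "finite_energy \<Omega> J F u \<longleftrightarrow>
     integrable (lebesgue_on \<Omega>) (\<lambda>x. nonlocal_op \<Omega> J u x * u x) \<and>
     integrable (lebesgue_on \<Omega>) (\<lambda>x. F (u x))"

definition chemical_potential ::
    "(real^'d) set \<Rightarrow> (real^'d \<Rightarrow> real) \<Rightarrow> real \<Rightarrow> (real \<Rightarrow> real) \<Rightarrow> (real^'d \<Rightarrow> real) \<Rightarrow> real^'d \<Rightarrow> real"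
  where
  "chemical_potential \<Omega> J \<epsilon> f u x = \<epsilon>\<^sup>2 * nonlocal_op \<Omega> J u x + f (u x)"

end

theory Submission imports Defs begin

text \<open>The scheme's update of \<open>R\<close> is implicit, but \<open>R (n + 1)\<close> is its only unknown once \<open>R n\<close> and
  \<open>\<phi> n\<close> are given: writing \<open>L\<close> for the nonlocal operator and \<open>q = (M L \<mu>bar, \<mu>bar)\<close>, it reads
  \<open>R (n + 1) * (1 + \<Delta>t * q) = R n\<close>. If \<open>q \<ge> 0\<close>, the factor \<open>1 + \<Delta>t * q\<close> is at least \<open>1\<close> for every
  \<open>\<Delta>t > 0\<close>, so positivity of \<open>R\<close> propagates from \<open>R 0\<close>, which is an exponential, and \<open>R\<close> does
  not increase (\<open>implicit_decay_step\<close>). Hence everything rests on positive semidefiniteness of the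
  nonlocal operator (\<open>nonlocal_op_nonneg\<close>).

  Semidefiniteness is the symmetrisation identity
  \<open>(L u, u) = 1/2 \<integral>\<integral> J (x - y) (u x - u y)\<^sup>2 dy dx\<close>, obtained by exchanging the roles of \<open>x\<close> and \<open>y\<close>.
  The exchange requires Fubini's theorem, hence absolute integrability on \<open>\<Omega> \<times> \<Omega>\<close>; this follows
  from \<open>u \<in> L\<^sup>2\<close> once \<open>\<integral> J (x - y) dy\<close> is bounded uniformly in \<open>x\<close>
  (\<open>symmetric_kernel_form_nonneg\<close>).

  The differences \<open>x - y\<close> of points of \<open>\<Omega> = box a b\<close> fill \<open>box (a - b) (b - a)\<close>, whereas \<open>J\<close> is
  known to be integrable and nonnegative on \<open>\<Omega>\<close> only. Periodicity closes this gap: finitely many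
  lattice translates of the closed cell cover the larger box. The kernel is also only Lebesgue
  measurable, and \<open>(x, y) \<mapsto> J (x - y)\<close> then need not be measurable for the (incomplete) product
  \<open>\<sigma>\<close>-algebra; it is therefore replaced by an almost everywhere equal even nonnegative Borel
  function (\<open>interaction_kernel_borel_version\<close>).\<close>

section \<open>Quadratic forms of symmetric kernels\<close>

text \<open>Expanding \<open>(v x - v y) * v x\<close> splits the integrand into \<open>A = K x y (v x)\<^sup>2\<close> and
  \<open>X = K x y (v x * v y)\<close>. The row bound \<open>C\<close> makes \<open>A\<close> integrable, symmetry transfers this to the
  mirror image \<open>B\<close> of \<open>A\<close>, with the same integral, and \<open>X\<close> is dominated by \<open>A + B\<close>. So the form is
  half the integral of \<open>A + B - 2 X = K x y (v x - v y)\<^sup>2\<close>.\<close>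

lemma symmetric_kernel_form_nonneg:
  fixes K :: "'a \<Rightarrow> 'a \<Rightarrow> real" and v :: "'a \<Rightarrow> real"
  assumes M: "sigma_finite_measure M"
    and K [measurable]: "case_prod K \<in> borel_measurable (M \<Otimes>\<^sub>M M)"
    and nonneg: "\<And>x y. 0 \<le> K x y"
    and sym: "\<And>x y. K x y = K y x"
    and bound: "\<And>x. x \<in> space M \<Longrightarrow> (\<integral>\<^sup>+ y. ennreal (K x y) \<partial>M) \<le> ennreal C"
    and v [measurable]: "v \<in> borel_measurable M"
    and v2: "integrable M (\<lambda>x. (v x)\<^sup>2)"
  shows "0 \<le> (LINT x|M. (LINT y|M. K x y * (v x - v y)) * v x)"
proof -
  interpret sigma_finite_measure M by fact
  interpret P: pair_sigma_finite M M ..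
  define A where "A = (\<lambda>(x, y). K x y * (v x)\<^sup>2)"
  define B where "B = (\<lambda>(x, y). K x y * (v y)\<^sup>2)"
  define X where "X = (\<lambda>(x, y). K x y * (v x * v y))"
  have A_meas [measurable]: "A \<in> borel_measurable (M \<Otimes>\<^sub>M M)"
    and X_meas [measurable]: "X \<in> borel_measurable (M \<Otimes>\<^sub>M M)"
    unfolding A_def X_def by measurable
  have A: "integrable (M \<Otimes>\<^sub>M M) A"
  proof (rule integrableI_bounded)
    have "(\<integral>\<^sup>+ p. ennreal (norm (A p)) \<partial>(M \<Otimes>\<^sub>M M))
        = (\<integral>\<^sup>+ x. \<integral>\<^sup>+ y. ennreal (norm (A (x, y))) \<partial>M \<partial>M)"
      by (rule nn_integral_fst [symmetric]) measurable
    also have "\<dots> = (\<integral>\<^sup>+ x. ennreal ((v x)\<^sup>2) * (\<integral>\<^sup>+ y. ennreal (K x y) \<partial>M) \<partial>M)"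
      by (intro nn_integral_cong)
        (simp add: A_def nonneg ennreal_mult' mult.commute nn_integral_cmult [symmetric])
    also have "\<dots> \<le> (\<integral>\<^sup>+ x. ennreal ((v x)\<^sup>2) * ennreal C \<partial>M)"
      by (intro nn_integral_mono mult_left_mono bound) auto
    also have "\<dots> = (\<integral>\<^sup>+ x. ennreal ((v x)\<^sup>2) \<partial>M) * ennreal C"
      by (rule nn_integral_multc) measurable
    also have "\<dots> < \<infinity>"
      using v2 by (auto simp: integrable_iff_bounded ennreal_mult_less_top)
    finally show "(\<integral>\<^sup>+ p. ennreal (norm (A p)) \<partial>(M \<Otimes>\<^sub>M M)) < \<infinity>" .
  qed measurable
  have swap: "(\<lambda>(x, y). A (y, x)) = B"
    using sym by (auto simp: A_def B_def)
  have B: "integrable (M \<Otimes>\<^sub>M M) B"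
    using P.integrable_product_swap [OF A] by (simp add: swap)
  have AB: "integral\<^sup>L (M \<Otimes>\<^sub>M M) B = integral\<^sup>L (M \<Otimes>\<^sub>M M) A"
    using P.integral_product_swap [OF A_meas] by (simp add: swap)
  have X: "integrable (M \<Otimes>\<^sub>M M) X"
  proof (rule Bochner_Integration.integrable_bound)
    show "integrable (M \<Otimes>\<^sub>M M) (\<lambda>p. A p + B p)" using A B by simp
    have "\<bar>s * t\<bar> \<le> s\<^sup>2 + t\<^sup>2" for s t :: real
      using sum_squares_bound [of "\<bar>s\<bar>" "\<bar>t\<bar>"] abs_ge_zero [of "s * t"]
      unfolding abs_mult power2_abs by linarith
    then have "norm (X p) \<le> norm (A p + B p)" for p
      by (cases p) (simp add: X_def A_def B_def nonneg abs_mult distrib_left [symmetric]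
          mult_left_mono)
    then show "AE p in M \<Otimes>\<^sub>M M. norm (X p) \<le> norm (A p + B p)" by simp
  qed measurable
  have "(LINT x|M. (LINT y|M. K x y * (v x - v y)) * v x) = (LINT x|M. LINT y|M. A (x, y) - X (x, y))"
    by (subst integral_mult_left_zero [symmetric])
      (simp add: A_def X_def algebra_simps power2_eq_square)
  also have "\<dots> = (LINT p|(M \<Otimes>\<^sub>M M). A p - X p)"
    using A X by (intro P.integral_fst' Bochner_Integration.integrable_diff)
  also have "\<dots> = (LINT p|(M \<Otimes>\<^sub>M M). A p + B p - 2 * X p) / 2"
    using A B X AB by simp
  also have "\<dots> \<ge> 0"
  proof -
    have "A p + B p - 2 * X p = (case p of (x, y) \<Rightarrow> K x y * (v x - v y)\<^sup>2)" for p
      by (cases p) (simp add: A_def B_def X_def algebra_simps power2_eq_square)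
    then have "0 \<le> A p + B p - 2 * X p" for p
      by (auto simp: nonneg split: prod.split)
    then show ?thesis by simp
  qed
  finally show ?thesis .
qed

section \<open>Periodic kernels beyond the cell\<close>

text \<open>The periods of a function form an additive group, which contains the generators
  \<open>axis i (b $ i - a $ i)\<close> and hence the lattice that they span.\<close>

lemma cell_periodic_lattice:
  fixes u :: "real^'d \<Rightarrow> real" and k :: "'d \<Rightarrow> int"
  assumes "cell_periodic a b u"
  shows "u (x + (\<chi> i. of_int (k i) * (b $ i - a $ i))) = u x"
proof -
  define S where "S = {c. \<forall>x. u (x + c) = u x}"
  have zero: "0 \<in> S" by (simp add: S_def)
  have add: "c + d \<in> S" if "c \<in> S" "d \<in> S" for c d
    using that by (simp add: S_def add.assoc [symmetric])
  have neg: "- c \<in> S" if "c \<in> S" for c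
  proof -
    have "u (x + - c) = u x" for x
      using that by (simp add: S_def) (metis diff_add_cancel)
    then show ?thesis by (simp add: S_def)
  qed
  have nat: "of_nat n *\<^sub>R c \<in> S" if "c \<in> S" for c and n :: nat
    by (induction n) (auto simp: zero that add scaleR_left_distrib)
  have int: "of_int m *\<^sub>R c \<in> S" if "c \<in> S" for c and m :: int
    by (cases m rule: int_cases2) (use nat [OF that] neg in auto)
  have axis: "axis i (b $ i - a $ i) \<in> S" for i
    using assms by (simp add: S_def cell_periodic_def)
  have "(\<Sum>i\<in>I. of_int (k i) *\<^sub>R axis i (b $ i - a $ i)) \<in> S" if "finite I" for I :: "'d set"
    using that by induction (auto intro: zero add int axis)
  moreover have "(\<Sum>i\<in>UNIV. of_int (k i) *\<^sub>R axis i (b $ i - a $ i))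
      = (\<chi> i. of_int (k i) * (b $ i - a $ i))"
    by (simp add: vec_eq_iff axis_def if_distrib [where f = "\<lambda>t. _ * t"] cong: if_cong)
  ultimately show ?thesis
    by (metis (mono_tags, lifting) S_def finite mem_Collect_eq)
qed

text \<open>Each coordinate is reduced into \<open>[a $ i, b $ i]\<close> by a floor; on a bounded set only finitely many
  values of these floors occur.\<close>

lemma finite_lattice_cover:
  fixes a b :: "real^'d"
  assumes ab: "\<And>i. a $ i < b $ i" and D: "bounded D"
  obtains T :: "(real^'d) set" where "finite T"
    "\<And>c. c \<in> T \<Longrightarrow> \<exists>k :: 'd \<Rightarrow> int. c = (\<chi> i. of_int (k i) * (b $ i - a $ i))"
    "D \<subseteq> (\<Union>c\<in>T. cbox (a + c) (b + c))"
proof -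
  define vec :: "('d \<Rightarrow> int) \<Rightarrow> real^'d" where "vec k = (\<chi> i. of_int (k i) * (b $ i - a $ i))" for k
  define idx where "idx x i = \<lfloor>(x $ i - a $ i) / (b $ i - a $ i)\<rfloor>" for x :: "real^'d" and i
  obtain r where r: "\<And>x. x \<in> D \<Longrightarrow> norm x \<le> r"
    using D by (auto simp: bounded_iff)
  define lo hi where "lo i = \<lfloor>(- r - a $ i) / (b $ i - a $ i)\<rfloor>"
    and "hi i = \<lfloor>(r - a $ i) / (b $ i - a $ i)\<rfloor>" for i
  define T where "T = vec ` (PiE UNIV (\<lambda>i. {lo i..hi i}))"
  show thesis
  proof
    show "finite T" unfolding T_def by (intro finite_imageI finite_PiE) auto
    show "\<exists>k :: 'd \<Rightarrow> int. c = (\<chi> i. of_int (k i) * (b $ i - a $ i))" if "c \<in> T" for c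
      using that by (auto simp: T_def vec_def)
    show "D \<subseteq> (\<Union>c\<in>T. cbox (a + c) (b + c))"
    proof
      fix x assume x: "x \<in> D"
      have "idx x i \<in> {lo i..hi i}" for i
      proof -
        have "\<bar>x $ i\<bar> \<le> r" using r [OF x] component_le_norm_cart [of x i] by linarith
        then show ?thesis
          using ab [of i] by (auto simp: idx_def lo_def hi_def intro!: floor_mono divide_right_mono)
      qed
      then have "vec (idx x) \<in> T" by (auto simp: T_def)
      moreover have "x \<in> cbox (a + vec (idx x)) (b + vec (idx x))"
      proof -
        have "a $ i + vec (idx x) $ i \<le> x $ i \<and> x $ i \<le> b $ i + vec (idx x) $ i" for i
        proof -
          define L where "L = b $ i - a $ i"
          define t where "t = (x $ i - a $ i) / L"
          have L: "0 < L" using ab [of i] by (simp add: L_def)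
          have x_eq: "x $ i = a $ i + t * L" using L by (simp add: t_def)
          have "of_int \<lfloor>t\<rfloor> * L \<le> t * L" "t * L \<le> (of_int \<lfloor>t\<rfloor> + 1) * L"
            using L by (auto intro!: mult_right_mono)
          then show ?thesis
            unfolding x_eq by (simp add: vec_def idx_def L_def [symmetric] t_def [symmetric])
              (simp add: L_def algebra_simps)
        qed
        then show ?thesis by (simp add: mem_box_cart)
      qed
      ultimately show "x \<in> (\<Union>c\<in>T. cbox (a + c) (b + c))" by blast
    qed
  qed
qed

text \<open>Nonnegativity is assumed on the open cell, so the faces of the translates have to be excluded;
  being finitely many, they are negligible together.\<close>

lemma interaction_kernel_locally_integrable_nonneg:
  fixes J :: "real^'d \<Rightarrow> real"
  assumes ab: "\<And>i. a $ i < b $ i" and J: "interaction_kernel a b J"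
    and D: "bounded D" "D \<in> sets lebesgue"
  shows "J absolutely_integrable_on D" and "AE x in lborel. x \<in> D \<longrightarrow> 0 \<le> J x"
proof -
  obtain T where T: "finite T"
    and lattice: "\<And>c. c \<in> T \<Longrightarrow> \<exists>k :: 'd \<Rightarrow> int. c = (\<chi> i. of_int (k i) * (b $ i - a $ i))"
    and cover: "D \<subseteq> (\<Union>c\<in>T. cbox (a + c) (b + c))"
    by (rule finite_lattice_cover [OF ab D(1)]) (rule that)
  have period: "J (c + x) = J x" if "c \<in> T" for c x
    using lattice [OF that] cell_periodic_lattice [of a b J x] J
    by (auto simp: interaction_kernel_def add.commute)
  have J_cell: "J absolutely_integrable_on cbox a b"
    using J unfolding absolutely_integrable_on_open_interval [symmetric]
    by (simp add: interaction_kernel_def integrable_restrict_space set_integrable_def)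
  have "J absolutely_integrable_on cbox (a + c) (b + c)" if "c \<in> T" for c
    using J_cell that period
    unfolding absolutely_integrable_on_def integrable_on_shift_cbox [symmetric]
    by (simp add: o_def)
  then have "J absolutely_integrable_on (\<Union>c\<in>T. cbox (a + c) (b + c))"
    using T by (intro set_integrable_UN) auto
  then show "J absolutely_integrable_on D"
    using D(2) cover by (rule set_integrable_subset)
  have "x \<in> (\<Union>c\<in>T. cbox (a + c) (b + c) - box (a + c) (b + c))" if x: "x \<in> D" "J x < 0" for x
  proof -
    obtain c where c: "c \<in> T" "x \<in> cbox (a + c) (b + c)" using cover x by blast
    have "J (x - c) = J x" using period [OF c(1), of "x - c"] by simp
    then have "x - c \<notin> box a b"
      using J x(2) by (auto simp: interaction_kernel_def not_le [symmetric])
    then have "x \<notin> box (a + c) (b + c)"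
      by (simp add: mem_box_cart less_diff_eq diff_less_eq)
    then show ?thesis using c by blast
  qed
  moreover have "negligible (\<Union>c\<in>T. cbox (a + c) (b + c) - box (a + c) (b + c))"
    using T by (intro negligible_Union finite_imageI) (auto simp: negligible_frontier_interval)
  ultimately have "negligible {x. \<not> (x \<in> D \<longrightarrow> 0 \<le> J x)}"
    by (elim negligible_subset) (auto simp: not_le)
  then have "AE x in lebesgue. x \<in> D \<longrightarrow> 0 \<le> J x"
    by (simp add: negligible_iff_null_sets completion.AE_iff_null_sets)
  then show "AE x in lborel. x \<in> D \<longrightarrow> 0 \<le> J x"
    by (simp add: AE_completion_iff)
qed

section \<open>A Borel version of the kernel\<close>

lemma AE_lborel_affine:
  fixes t :: "'a :: euclidean_space"
  assumes "AE x in lborel. P x" "c \<noteq> 0"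
  shows "AE x in lborel. P (t + c *\<^sub>R x)"
proof -
  have "AE x in distr lborel borel (\<lambda>x. t + c *\<^sub>R x). P x"
    using assms by (subst (asm) lborel_affine [of c t]) (auto simp: AE_density)
  then show ?thesis by (rule AE_distrD [rotated]) measurable
qed

lemma nn_integral_lborel_reflect:
  fixes t :: "'a :: euclidean_space"
  assumes [measurable]: "f \<in> borel_measurable borel"
  shows "(\<integral>\<^sup>+ y. f (t - y) \<partial>lborel) = (\<integral>\<^sup>+ y. f y \<partial>lborel)"
proof -
  have "(\<integral>\<^sup>+ y. f y \<partial>lborel) = (\<integral>\<^sup>+ y. f y \<partial>(distr lborel borel (\<lambda>y. t - y)))"
    by (subst lborel_affine [of "-1" t]) (simp_all add: density_1)
  then show ?thesis by (simp add: nn_integral_distr)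
qed

text \<open>A Borel function that agrees almost everywhere with \<open>J\<close> need be neither even nor nonnegative.
  Averaging it with its reflection and truncating at \<open>0\<close> restores both properties everywhere and
  changes it only on a null set, as \<open>J\<close> is even and almost everywhere nonnegative on the symmetric
  box.\<close>

lemma interaction_kernel_borel_version:
  fixes J :: "real^'d \<Rightarrow> real"
  assumes ab: "\<And>i. a $ i < b $ i" and J: "interaction_kernel a b J"
  obtains j :: "real^'d \<Rightarrow> real" where "j \<in> borel_measurable borel" "\<And>x. 0 \<le> j x"
    "\<And>x. j (- x) = j x" "(\<integral>\<^sup>+ x. ennreal (j x) \<partial>lborel) < \<infinity>"
    "AE x in lborel. x \<in> cbox (a - b) (b - a) \<longrightarrow> J x = j x"
proof -
  define D where "D = cbox (a - b) (b - a)"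
  define g where "g x = indicat_real D x * J x" for x
  have J_int: "J absolutely_integrable_on D" and J_nn: "AE x in lborel. x \<in> D \<longrightarrow> 0 \<le> J x"
    using interaction_kernel_locally_integrable_nonneg [OF ab J, of D] by (auto simp: D_def)
  have g: "integrable lebesgue g"
    using J_int by (simp add: set_integrable_def g_def [abs_def])
  have "- x \<in> D \<longleftrightarrow> x \<in> D" for x
    by (auto simp: D_def mem_box_cart algebra_simps)
  then have g_even: "g (- x) = g x" for x
    using J by (simp add: g_def interaction_kernel_def indicator_def)
  obtain h where h [measurable]: "h \<in> borel_measurable borel" and gh: "AE x in lborel. g x = h x"
    using completion_ex_borel_measurable_real [of g lborel] g by (auto dest: borel_measurable_integrable)
  define j where "j x = max 0 ((h x + h (- x)) / 2)" for x
  have gj: "AE x in lborel. g x = j x"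
  proof -
    have "AE x in lborel. g (- x) = h (- x)"
      using AE_lborel_affine [OF gh, of "-1" 0] by simp
    with gh J_nn show ?thesis
    proof eventually_elim
      case (elim x)
      have "0 \<le> g x" using \<open>x \<in> D \<longrightarrow> 0 \<le> J x\<close> by (simp add: g_def indicator_def)
      with elim show ?case by (simp add: j_def g_even)
    qed
  qed
  show thesis
  proof
    show [measurable]: "j \<in> borel_measurable borel" unfolding j_def by measurable
    show "0 \<le> j x" for x by (simp add: j_def)
    show "j (- x) = j x" for x by (simp add: j_def add.commute)
    have "(\<integral>\<^sup>+ x. ennreal (j x) \<partial>lborel) \<le> (\<integral>\<^sup>+ x. ennreal (norm (g x)) \<partial>lborel)"
      using gj by (intro nn_integral_mono_AE) (auto elim!: eventually_mono intro!: ennreal_leI)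
    also have "\<dots> < \<infinity>"
      using g by (simp add: integrable_iff_bounded nn_integral_completion)
    finally show "(\<integral>\<^sup>+ x. ennreal (j x) \<partial>lborel) < \<infinity>" .
    show "AE x in lborel. x \<in> cbox (a - b) (b - a) \<longrightarrow> J x = j x"
      using gj by eventually_elim (simp add: g_def D_def split: split_indicator_asm)
  qed
qed

section \<open>Positive semidefiniteness of the nonlocal operator\<close>

text \<open>For each fixed \<open>x\<close> the inner integral does not notice the passage from \<open>J\<close> to its Borel version
  \<open>j\<close>, because \<open>y \<mapsto> x - y\<close> preserves null sets. The mass of \<open>j\<close> on the whole space is then a
  row bound for the kernel \<open>j (x - y)\<close>.\<close>

lemma nonlocal_op_nonneg:
  fixes J u :: "real^'d \<Rightarrow> real"
  assumes ab: "\<And>i. a $ i < b $ i" and J: "interaction_kernel a b J"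
    and u: "square_integrable (box a b) u"
  shows "0 \<le> L2_inner (box a b) (nonlocal_op (box a b) J u) u"
proof -
  define \<Omega> where "\<Omega> = box a b"
  define M where "M = lebesgue_on \<Omega>"
  obtain j :: "real^'d \<Rightarrow> real" where j [measurable]: "j \<in> borel_measurable borel"
    and j_nn: "\<And>x. 0 \<le> j x" and j_even: "\<And>x. j (- x) = j x"
    and j_fin: "(\<integral>\<^sup>+ x. ennreal (j x) \<partial>lborel) < \<infinity>"
    and Jj: "AE x in lborel. x \<in> cbox (a - b) (b - a) \<longrightarrow> J x = j x"
    by (rule interaction_kernel_borel_version [OF ab J]) (rule that)
  have [simp]: "\<Omega> \<in> sets lebesgue" "space M = \<Omega>" by (simp_all add: \<Omega>_def M_def)
  have [measurable]: "(\<lambda>x. x) \<in> M \<rightarrow>\<^sub>M borel"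
    unfolding M_def by (intro measurable_restrict_space1 measurable_completion) simp
  \<comment> \<open>\<open>M\<close> carries the Lebesgue sets, so \<open>u\<close> can be used as it is; only the kernel, a function of
    two variables, has to be Borel.\<close>
  have u_meas [measurable]: "u \<in> borel_measurable M" and u2: "integrable M (\<lambda>x. (u x)\<^sup>2)"
    using u by (simp_all add: square_integrable_def M_def \<Omega>_def)
  have op: "nonlocal_op \<Omega> J u x = (LINT y|M. j (x - y) * (u x - u y))" if x: "x \<in> \<Omega>" for x
  proof -
    have "x - y \<in> cbox (a - b) (b - a)" if "y \<in> \<Omega>" for y
      using x that by (auto simp: \<Omega>_def mem_box_cart intro!: less_imp_le diff_strict_mono)
    moreover have "AE y in lborel. x - y \<in> cbox (a - b) (b - a) \<longrightarrow> J (x - y) = j (x - y)"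
      using AE_lborel_affine [OF Jj, of "-1" x] by simp
    ultimately have "AE y in lborel. y \<in> \<Omega> \<longrightarrow> J (x - y) = j (x - y)"
      by (auto elim!: eventually_mono)
    then have ae: "AE y in lebesgue. y \<in> \<Omega> \<longrightarrow> J (x - y) = j (x - y)"
      by (rule AE_completion)
    have m: "(\<lambda>y. j (x - y) * (u x - u y)) \<in> borel_measurable M" by measurable
    have "(\<lambda>y. indicator \<Omega> y *\<^sub>R (J (x - y) * (u x - u y))) \<in> borel_measurable lebesgue"
    proof (rule borel_measurable_AE)
      show "(\<lambda>y. indicator \<Omega> y *\<^sub>R (j (x - y) * (u x - u y))) \<in> borel_measurable lebesgue"
        using m by (simp add: M_def borel_measurable_restrict_space_iff)
      show "AE y in lebesgue. indicator \<Omega> y *\<^sub>R (j (x - y) * (u x - u y))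
          = indicator \<Omega> y *\<^sub>R (J (x - y) * (u x - u y))"
        using ae by eventually_elim (simp split: split_indicator)
    qed
    then have m': "(\<lambda>y. J (x - y) * (u x - u y)) \<in> borel_measurable M"
      by (simp add: M_def borel_measurable_restrict_space_iff)
    have "AE y in M. J (x - y) * (u x - u y) = j (x - y) * (u x - u y)"
      unfolding M_def using ae by (auto simp: AE_restrict_space_iff elim!: eventually_mono)
    then show ?thesis
      unfolding nonlocal_op_def M_def [symmetric] by (intro integral_cong_AE m m')
  qed
  have "0 \<le> (LINT x|M. (LINT y|M. j (x - y) * (u x - u y)) * u x)"
  proof (rule symmetric_kernel_form_nonneg)
    have "finite_measure M"
      unfolding M_def \<Omega>_def by (intro finite_measure_lebesgue_on) simp
    then show "sigma_finite_measure M" by (rule finite_measure.axioms)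
    show "(\<lambda>(x, y). j (x - y)) \<in> borel_measurable (M \<Otimes>\<^sub>M M)" by measurable
    show "j (x - y) = j (y - x)" for x y using j_even [of "x - y"] by simp
    show "(\<integral>\<^sup>+ y. ennreal (j (x - y)) \<partial>M) \<le> ennreal (enn2real (\<integral>\<^sup>+ y. ennreal (j y) \<partial>lborel))" for x
    proof -
      have "(\<integral>\<^sup>+ y. ennreal (j (x - y)) \<partial>M) \<le> (\<integral>\<^sup>+ y. ennreal (j (x - y)) \<partial>lebesgue)"
        unfolding M_def by (simp add: nn_integral_restrict_space)
          (intro nn_integral_mono, simp split: split_indicator)
      also have "\<dots> = (\<integral>\<^sup>+ y. ennreal (j y) \<partial>lborel)"
        by (simp add: nn_integral_completion nn_integral_lborel_reflect [of "\<lambda>y. ennreal (j y)"])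
      finally show ?thesis using j_fin by simp
    qed
  qed (fact j_nn u_meas u2)+
  also have "\<dots> = L2_inner \<Omega> (nonlocal_op \<Omega> J u) u"
    unfolding L2_inner_def M_def [symmetric] by (intro Bochner_Integration.integral_cong) (auto simp: op)
  finally show ?thesis by (simp add: \<Omega>_def)
qed

section \<open>Energy stability\<close>

lemma implicit_decay_step:
  fixes r r' h q :: real
  assumes step: "(r' - r) / h = r' * (- q)" and "0 < h" "0 \<le> q" "0 < r"
  shows "r' - r = - r' * h * q" "0 < r'" "r' \<le> r"
proof -
  show eq: "r' - r = - r' * h * q" using step \<open>0 < h\<close> by (simp add: field_simps)
  then have "r' * (1 + h * q) = r" by (simp add: algebra_simps)
  moreover have pos: "0 < 1 + h * q" using assms by (simp add: add_pos_nonneg)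
  ultimately show r': "0 < r'" using \<open>0 < r\<close> by (metis zero_less_mult_pos2)
  have "0 \<le> r' * h * q" using r' assms by simp
  then show "r' \<le> r" using eq by simp
qed

theorem theorem3p1:
  fixes a b :: "real^'d" and \<Omega> :: "(real^'d) set"
    and J :: "real^'d \<Rightarrow> real" and F f :: "real \<Rightarrow> real"
    and M \<epsilon> \<Delta>t :: real and N\<^sub>t :: nat
    and \<phi>\<^sub>0 :: "real^'d \<Rightarrow> real"
    and \<phi> \<mu> \<mu>bar :: "nat \<Rightarrow> real^'d \<Rightarrow> real" and R :: "nat \<Rightarrow> real"
  assumes dim: "CARD('d) \<in> {1, 2, 3}"
    and cell: "\<forall>i. a $ i < b $ i" "\<Omega> = box a b"
    and kernel: "interaction_kernel a b J"
    and potential: "\<forall>s. (F has_real_derivative f s) (at s)" "continuous_on UNIV f"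
    and params: "0 < \<Delta>t" "1 \<le> N\<^sub>t" "0 < M" "0 < \<epsilon>" "\<epsilon> \<le> 1"
    and mubar: "\<forall>n<N\<^sub>t. \<mu>bar n = chemical_potential \<Omega> J \<epsilon> f (\<phi> n)"
    and periodic: "\<forall>n\<le>N\<^sub>t. cell_periodic a b (\<phi> n)"
      "\<forall>n\<in>{1..N\<^sub>t}. cell_periodic a b (\<mu> n)"
    and L2: "\<forall>n\<le>N\<^sub>t. square_integrable \<Omega> (\<phi> n)"
      "\<forall>n\<le>N\<^sub>t. square_integrable \<Omega> (\<lambda>x. f (\<phi> n x))"
      "\<forall>n\<in>{1..N\<^sub>t}. square_integrable \<Omega> (\<mu> n)"
      "\<forall>n<N\<^sub>t. square_integrable \<Omega> (\<mu>bar n)"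
    and energy: "\<forall>n\<le>N\<^sub>t. finite_energy \<Omega> J F (\<phi> n)"
    and initial: "\<phi> 0 = \<phi>\<^sub>0" "R 0 = exp (free_energy \<Omega> J \<epsilon> F (\<phi> 0))"
    and scheme_phi: "\<forall>n<N\<^sub>t. AE x in lebesgue_on \<Omega>.
      (\<phi> (n + 1) x - \<phi> n x) / \<Delta>t = - M * nonlocal_op \<Omega> J (\<mu> (n + 1)) x"
    and scheme_mu: "\<forall>n<N\<^sub>t. AE x in lebesgue_on \<Omega>.
      \<mu> (n + 1) x = \<epsilon>\<^sup>2 * nonlocal_op \<Omega> J (\<phi> (n + 1)) x
        + R (n + 1) / exp (free_energy \<Omega> J \<epsilon> F (\<phi> n)) * f (\<phi> n x)"
    and scheme_R: "\<forall>n<N\<^sub>t.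
      (R (n + 1) - R n) / \<Delta>t
        = R (n + 1) * L2_inner \<Omega> (\<lambda>x. - M * nonlocal_op \<Omega> J (\<mu>bar n) x) (\<mu>bar n)"
  shows "\<forall>n<N\<^sub>t.
      R (n + 1) - R n
        = - R (n + 1) * \<Delta>t * L2_inner \<Omega> (\<lambda>x. M * nonlocal_op \<Omega> J (\<mu>bar n) x) (\<mu>bar n)
    \<and> - R (n + 1) * \<Delta>t * L2_inner \<Omega> (\<lambda>x. M * nonlocal_op \<Omega> J (\<mu>bar n) x) (\<mu>bar n) \<le> 0
    \<and> 0 < R n \<and> 0 < R (n + 1)
    \<and> ln (R (n + 1)) - ln (R n) \<le> 0"
proof -
  have q_nonneg: "0 \<le> L2_inner \<Omega> (nonlocal_op \<Omega> J (\<mu>bar n)) (\<mu>bar n)" if "n < N\<^sub>t" for n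
    using nonlocal_op_nonneg [of a b J "\<mu>bar n"] cell kernel L2(4) that by auto
  have pull: "L2_inner \<Omega> (\<lambda>x. c * nonlocal_op \<Omega> J w x) w = c * L2_inner \<Omega> (nonlocal_op \<Omega> J w) w"
    for c w by (simp add: L2_inner_def mult.assoc)
  let ?q = "\<lambda>n. L2_inner \<Omega> (\<lambda>x. M * nonlocal_op \<Omega> J (\<mu>bar n) x) (\<mu>bar n)"
  have q: "0 \<le> ?q n" if "n < N\<^sub>t" for n
    using q_nonneg [OF that] params(3) by (simp add: pull)
  have step: "(R (n + 1) - R n) / \<Delta>t = R (n + 1) * (- ?q n)" if "n < N\<^sub>t" for n
    using scheme_R that pull [of "- M"] pull [of M] by simp
  have pos: "n \<le> N\<^sub>t \<Longrightarrow> 0 < R n" for n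
  proof (induction n)
    case 0
    show ?case using initial(2) by simp
  next
    case (Suc n)
    then show ?case
      using implicit_decay_step(2) [OF step params(1) q, of n] by simp
  qed
  show ?thesis
  proof (intro allI impI)
    fix n assume n: "n < N\<^sub>t"
    have Rn: "0 < R n" using n by (intro pos) simp
    note decay = implicit_decay_step [OF step [OF n] params(1) q [OF n] Rn]
    have "ln (R (n + 1)) \<le> ln (R n)" using decay Rn by simp
    then show "R (n + 1) - R n = - R (n + 1) * \<Delta>t * ?q n \<and> - R (n + 1) * \<Delta>t * ?q n \<le> 0
      \<and> 0 < R n \<and> 0 < R (n + 1) \<and> ln (R (n + 1)) - ln (R n) \<le> 0"
      using decay Rn by (intro conjI) simp_all
  qed
qed

end
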